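(* The set of real numbers $r$ such that $r$ is a root of $\mathrm{NRel}(G;p)$ for some finite simple graph $G$ is unbounded.
   Context: For a finite simple undirected graph $G$ with $n$ nodes, a connected set of $G$ is a nonempty subset of nodes inducing a connected subgraph. Let $c_k$ be the number of connected sets of $G$ of order $k$. The node reliability polynomial of $G$ is $\mathrm{NRel}(G;p)=\sum_{k=1}^n c_k p^k(1-p)^{n-k}$, regarded as a polynomial in $p$; its roots are the node reliability roots of $G$. *)

theory Defs
  imports "HOL-Analysis.Analysis" "HOL-Computational_Algebra.Polynomial"
    "Graph_Theory.Graph_Theory"
begin

text \<open>
  Finite simple undirected graphs are modelled by the locale \<^locale>\<open>pair_graph\<close>: a finite vertex
  set with a symmetric irreflexive set of ordered pairs.
\<close>

definition connected_sets :: "'a pair_pre_digraph \<Rightarrow> nat \<Rightarrow> 'a set set" where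
  "connected_sets G k =
     {S. S \<subseteq> pverts G \<and> S \<noteq> {} \<and> card S = k \<and>
         Digraph_Component.connected (with_proj G \<restriction> S)}"

text \<open>
  For the graph without vertices this is the zero polynomial, so statements about roots must
  exclude that graph; for any other finite graph it is nonzero, its linear coefficient being the
  number of vertices.
\<close>

definition NRel :: "'a pair_pre_digraph \<Rightarrow> real poly" where
  "NRel G = (let n = card (pverts G) in
     \<Sum>k = 1..n. smult (real (card (connected_sets G k))) ([:0, 1:] ^ k * [:1, -1:] ^ (n - k)))"

end

theory Submission
  imports Defs
begin

text \<open>
  Take \<open>G\<close> to be the complement of the path on \<open>n\<close> vertices. A set of vertices is disconnected
  in \<open>G\<close> iff the path contains a spanning complete bipartite graph on it, so the only disconnected
  sets are the \<open>n - 1\<close> pairs \<open>{i, i + 1}\<close> and the \<open>n - 2\<close> triples \<open>{i, i + 1, i + 2}\<close>. In terms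
  of \<open>w = 1 / (1 - p)\<close> the node reliability polynomial becomes, up to the factor \<open>w\<^sup>-\<^sup>n\<close>,
  \<open>w\<^sup>n - 1 - (w - 1)\<^sup>2 (1 + (n - 2) w)\<close>. This is \<open>- 2\<close> at \<open>w = 0\<close>, while at any fixed \<open>w < 0\<close>
  close to \<open>0\<close> it is positive for large \<open>n\<close>. Hence there are roots \<open>w < 0\<close> arbitrarily close
  to \<open>0\<close>, and \<open>p = 1 - 1 / w\<close> is then arbitrarily large.
\<close>

definition separation :: "('a, 'b) pre_digraph \<Rightarrow> 'a set \<Rightarrow> 'a set \<Rightarrow> bool" where
  "separation G A B \<longleftrightarrow> A \<noteq> {} \<and> B \<noteq> {} \<and> A \<inter> B = {} \<and> A \<union> B = verts G \<and>
     (\<forall>a\<in>A. \<forall>b\<in>B. \<not> a \<rightarrow>\<^bsub>G\<^esub> b \<and> \<not> b \<rightarrow>\<^bsub>G\<^esub> a)"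

lemma mem_symcl_iff: "(x, y) \<in> R\<^sup>s \<longleftrightarrow> (x, y) \<in> R \<or> (y, x) \<in> R"
  by (auto simp: symcl_def)

lemma dominates_induce_subgraph_iff:
  "u \<rightarrow>\<^bsub>G \<restriction> S\<^esub> v \<longleftrightarrow> u \<in> S \<and> v \<in> S \<and> u \<rightarrow>\<^bsub>G\<^esub> v"
  by (auto simp: arcs_ends_conv)

lemma rtrancl_on_closed:
  assumes "(a, b) \<in> rtrancl_on F R" and "a \<in> A"
    and "\<And>x y. (x, y) \<in> R \<Longrightarrow> x \<in> A \<Longrightarrow> y \<in> F \<Longrightarrow> y \<in> A"
  shows "b \<in> A"
  using assms(1)
proof (induction rule: rtrancl_on_induct)
  case base
  show ?case
    by fact
next
  case (step y z)
  show ?case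
    using step.hyps(2) step.IH step.hyps(4) by (rule assms(3))
qed

lemma connected_imp_no_separation:
  assumes "Digraph_Component.connected G"
  shows "\<not> separation G A B"
proof
  assume sep: "separation G A B"
  then obtain a b where ab: "a \<in> A" "b \<in> B"
    unfolding separation_def by blast
  then have "a \<in> verts G" "b \<in> verts G"
    using sep by (auto simp: separation_def)
  then have "(a, b) \<in> rtrancl_on (verts G) ((arcs_ends G)\<^sup>s)"
    using assms by (simp add: connected_conv)
  then have "b \<in> A"
    using ab(1) by (rule rtrancl_on_closed) (use sep in \<open>auto simp: separation_def mem_symcl_iff\<close>)
  with sep ab(2) show False
    by (auto simp: separation_def)
qed

lemma connected_if_no_separation:
  assumes nonempty: "verts G \<noteq> {}" and no_sep: "\<nexists>A B. separation G A B"
  shows "Digraph_Component.connected G"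
  unfolding connected_conv
proof (intro conjI ballI)
  fix u v
  assume "u \<in> verts G" "v \<in> verts G"
  define A where "A = {x \<in> verts G. (u, x) \<in> rtrancl_on (verts G) ((arcs_ends G)\<^sup>s)}"
  have "u \<in> A"
    using \<open>u \<in> verts G\<close> by (simp add: A_def)
  moreover have "\<not> a \<rightarrow>\<^bsub>G\<^esub> b \<and> \<not> b \<rightarrow>\<^bsub>G\<^esub> a" if "a \<in> A" "b \<in> verts G - A" for a b
    using that by (auto simp: A_def mem_symcl_iff intro: rtrancl_on_into_rtrancl_on)
  ultimately have "separation G A (verts G - A)" if "verts G - A \<noteq> {}"
    using that by (auto simp: separation_def A_def)
  with no_sep have "verts G \<subseteq> A"
    by blast
  with \<open>v \<in> verts G\<close> show "(u, v) \<in> rtrancl_on (verts G) ((arcs_ends G)\<^sup>s)"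
    by (auto simp: A_def)
qed (fact nonempty)

lemma connected_iff_no_separation:
  "Digraph_Component.connected G \<longleftrightarrow> verts G \<noteq> {} \<and> (\<nexists>A B. separation G A B)"
proof
  assume "Digraph_Component.connected G"
  then show "verts G \<noteq> {} \<and> (\<nexists>A B. separation G A B)"
    by (simp add: connected_imp_no_separation) (simp add: connected_conv)
qed (simp add: connected_if_no_separation)

definition disconnected_sets :: "'a pair_pre_digraph \<Rightarrow> 'a set set" where
  "disconnected_sets G =
     {S. S \<subseteq> pverts G \<and> S \<noteq> {} \<and> \<not> Digraph_Component.connected (with_proj G \<restriction> S)}"

lemma disconnected_sets_iff_separation:
  "S \<in> disconnected_sets G \<longleftrightarrow>
     S \<subseteq> pverts G \<and> (\<exists>A B. separation (with_proj G \<restriction> S) A B)"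
proof -
  have "S \<noteq> {}" if "separation (with_proj G \<restriction> S) A B" for A B
    using that by (simp add: separation_def) blast
  then show ?thesis
    unfolding disconnected_sets_def connected_iff_no_separation mem_Collect_eq induce_subgraph_verts
    by blast
qed

lemma sum_subsets_power_card:
  fixes x y :: "'b::comm_semiring_1"
  assumes "finite V"
  shows "(\<Sum>S\<in>Pow V. x ^ card S * y ^ (card V - card S)) = (x + y) ^ card V"
proof -
  have "(x + y) ^ card V = (\<Sum>S\<in>Pow V. x ^ card S * y ^ card (V - S))"
    using prod_add[OF assms, of "\<lambda>_. x" "\<lambda>_. y"] by simp
  also have "\<dots> = (\<Sum>S\<in>Pow V. x ^ card S * y ^ (card V - card S))"
    using assms by (intro sum.cong) (auto simp: card_Diff_subset finite_subset)
  finally show ?thesis ..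
qed

lemma poly_NRel_eq_sum_connected:
  assumes "finite (pverts G)"
  shows "poly (NRel G) p =
    (\<Sum>S | S \<subseteq> pverts G \<and> S \<noteq> {} \<and> Digraph_Component.connected (with_proj G \<restriction> S).
       p ^ card S * (1 - p) ^ (card (pverts G) - card S))"
proof -
  define n where "n = card (pverts G)"
  define C where
    "C = {S. S \<subseteq> pverts G \<and> S \<noteq> {} \<and> Digraph_Component.connected (with_proj G \<restriction> S)}"
  have "finite C"
    using assms by (simp add: C_def)
  have "card ` C \<subseteq> {1..n}"
    using assms by (auto simp: C_def n_def card_mono card_gt_0_iff finite_subset Suc_le_eq)
  have connected_sets: "connected_sets G k = {S \<in> C. card S = k}" for k
    by (auto simp: connected_sets_def C_def)
  have "poly (NRel G) p =
      (\<Sum>k = 1..n. real (card (connected_sets G k)) * (p ^ k * (1 - p) ^ (n - k)))"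
    by (simp add: NRel_def Let_def poly_sum n_def)
  also have "\<dots> = (\<Sum>k = 1..n. \<Sum>S | S \<in> C \<and> card S = k. p ^ card S * (1 - p) ^ (n - card S))"
    by (intro sum.cong) (simp_all add: connected_sets)
  also have "\<dots> = (\<Sum>S\<in>C. p ^ card S * (1 - p) ^ (n - card S))"
    using \<open>finite C\<close> \<open>card ` C \<subseteq> {1..n}\<close> by (intro sum.group) auto
  finally show ?thesis
    by (simp add: C_def n_def)
qed

lemma poly_NRel_eq_sum_disconnected:
  assumes "finite (pverts G)"
  shows "poly (NRel G) p = 1 - (1 - p) ^ card (pverts G) -
    (\<Sum>S\<in>disconnected_sets G. p ^ card S * (1 - p) ^ (card (pverts G) - card S))"
proof -
  define t where "t S = p ^ card S * (1 - p) ^ (card (pverts G) - card S)" for S :: "'a set"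
  have "{S. S \<subseteq> pverts G \<and> S \<noteq> {} \<and> Digraph_Component.connected (with_proj G \<restriction> S)} =
      (Pow (pverts G) - {{}}) - disconnected_sets G"
    by (auto simp: disconnected_sets_def)
  then have "poly (NRel G) p = sum t ((Pow (pverts G) - {{}}) - disconnected_sets G)"
    by (simp add: poly_NRel_eq_sum_connected[OF assms] t_def)
  also have "\<dots> = sum t (Pow (pverts G) - {{}}) - sum t (disconnected_sets G)"
    using assms by (intro sum_diff) (auto simp: disconnected_sets_def)
  also have "sum t (Pow (pverts G) - {{}}) = sum t (Pow (pverts G)) - t {}"
    using assms by (simp add: sum_diff1)
  also have "sum t (Pow (pverts G)) = 1"
    using sum_subsets_power_card[OF assms, of p "1 - p"] by (simp add: t_def)
  finally show ?thesis
    by (simp add: t_def)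
qed

definition complement_graph :: "'a pair_pre_digraph \<Rightarrow> 'a pair_pre_digraph" where
  "complement_graph G = \<lparr> pverts = pverts G,
     parcs = {(u, v). u \<in> pverts G \<and> v \<in> pverts G \<and> u \<noteq> v \<and> (u, v) \<notin> parcs G} \<rparr>"

lemma pverts_complement_graph [simp]: "pverts (complement_graph G) = pverts G"
  by (simp add: complement_graph_def)

lemma mem_parcs_complement_graph [simp]:
  "(u, v) \<in> parcs (complement_graph G) \<longleftrightarrow>
     u \<in> pverts G \<and> v \<in> pverts G \<and> u \<noteq> v \<and> (u, v) \<notin> parcs G"
  by (simp add: complement_graph_def)

lemma (in pair_pseudo_graph) pair_graph_complement_graph: "pair_graph (complement_graph G)"
proof
  have "parcs (complement_graph G) \<subseteq> pverts G \<times> pverts G"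
    by auto
  then show "finite (parcs (complement_graph G))"
    by (rule finite_subset) simp
  show "symmetric (with_proj (complement_graph G))"
    by (auto simp: symmetric_def intro!: symI dest: arcs_symmetric)
qed auto

lemma (in pair_bidirected_digraph) separation_induce_complement_graph_iff:
  assumes "S \<subseteq> pverts G"
  shows "separation (with_proj (complement_graph G) \<restriction> S) A B \<longleftrightarrow>
    A \<noteq> {} \<and> B \<noteq> {} \<and> A \<union> B = S \<and> A \<times> B \<subseteq> parcs G"
proof -
  define H where "H = with_proj (complement_graph G) \<restriction> S"
  have "\<not> a \<rightarrow>\<^bsub>H\<^esub> b \<and> \<not> b \<rightarrow>\<^bsub>H\<^esub> a \<longleftrightarrow> (a, b) \<in> parcs G" if "a \<in> S" "b \<in> S" "a \<noteq> b" for a b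
    using that assms arcs_symmetric[of a b] arcs_symmetric[of b a]
    by (auto simp: H_def dominates_induce_subgraph_iff)
  then have "(\<forall>a\<in>A. \<forall>b\<in>B. \<not> a \<rightarrow>\<^bsub>H\<^esub> b \<and> \<not> b \<rightarrow>\<^bsub>H\<^esub> a) \<longleftrightarrow> A \<times> B \<subseteq> parcs G"
    if "A \<inter> B = {}" "A \<union> B = S"
    using that unfolding subset_iff by blast
  moreover have "A \<inter> B = {}" if "A \<times> B \<subseteq> parcs G"
    using that pair_no_loops[of "(x, x)" for x] by auto
  moreover have "verts H = S"
    by (simp add: H_def)
  ultimately show ?thesis
    unfolding separation_def H_def[symmetric] by blast
qed

lemma (in pair_bidirected_digraph) disconnected_sets_complement_graph:
  "disconnected_sets (complement_graph G) =
    {A \<union> B | A B. A \<noteq> {} \<and> B \<noteq> {} \<and> A \<times> B \<subseteq> parcs G}"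
proof (intro subset_antisym subsetI)
  fix S
  assume "S \<in> disconnected_sets (complement_graph G)"
  then obtain A B where "S \<subseteq> pverts G" "separation (with_proj (complement_graph G) \<restriction> S) A B"
    by (auto simp: disconnected_sets_iff_separation)
  then have "A \<union> B = S" "A \<noteq> {}" "B \<noteq> {}" "A \<times> B \<subseteq> parcs G"
    by (simp_all add: separation_induce_complement_graph_iff)
  then show "S \<in> {A \<union> B | A B. A \<noteq> {} \<and> B \<noteq> {} \<and> A \<times> B \<subseteq> parcs G}"
    by blast
next
  fix S
  assume "S \<in> {A \<union> B | A B. A \<noteq> {} \<and> B \<noteq> {} \<and> A \<times> B \<subseteq> parcs G}"
  then obtain A B where biclique: "A \<union> B = S" "A \<noteq> {}" "B \<noteq> {}" "A \<times> B \<subseteq> parcs G"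
    by blast
  then have "S \<subseteq> pverts G"
    by (auto dest: in_arcsD1 in_arcsD2)
  moreover from this biclique
  have "separation (with_proj (complement_graph G) \<restriction> S) A B"
    by (simp add: separation_induce_complement_graph_iff)
  ultimately show "S \<in> disconnected_sets (complement_graph G)"
    unfolding disconnected_sets_iff_separation pverts_complement_graph by blast
qed

definition path_graph :: "nat \<Rightarrow> nat pair_pre_digraph" where
  "path_graph n =
     \<lparr> pverts = {..<n}, parcs = {(i, j). i < n \<and> j < n \<and> (j = Suc i \<or> i = Suc j)} \<rparr>"

lemma pverts_path_graph [simp]: "pverts (path_graph n) = {..<n}"
  by (simp add: path_graph_def)

lemma mem_parcs_path_graph [simp]:
  "(i, j) \<in> parcs (path_graph n) \<longleftrightarrow> i < n \<and> j < n \<and> (j = Suc i \<or> i = Suc j)"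
  by (simp add: path_graph_def)

lemma pair_graph_path_graph: "pair_graph (path_graph n)"
proof
  have "parcs (path_graph n) \<subseteq> {..<n} \<times> {..<n}"
    by auto
  then show "finite (parcs (path_graph n))"
    by (rule finite_subset) simp
  show "symmetric (with_proj (path_graph n))"
    by (auto simp: symmetric_def intro!: symI)
qed auto

definition path_segments :: "nat \<Rightarrow> nat \<Rightarrow> nat set set" where
  "path_segments n k = (\<lambda>i. {i..<i + k}) ` {i. i + k \<le> n}"

lemma path_segmentsI: "i + k \<le> n \<Longrightarrow> {i..<i + k} \<in> path_segments n k"
  by (auto simp: path_segments_def)

lemma finite_path_segments: "finite (path_segments n k)"
  by (rule finite_subset[of _ "Pow {..<n}"]) (auto simp: path_segments_def)

lemma card_mem_path_segments: "S \<in> path_segments n k \<Longrightarrow> card S = k"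
  by (auto simp: path_segments_def)

lemma card_path_segments:
  assumes "k > 0"
  shows "card (path_segments n k) = Suc n - k"
proof -
  have "inj_on (\<lambda>i. {i..<i + k}) {i. i + k \<le> n}"
    using assms by (auto simp: inj_on_def atLeastLessThan_eq_iff)
  moreover have "{i. i + k \<le> n} = {..<Suc n - k}"
    by auto
  ultimately show ?thesis
    by (simp add: path_segments_def card_image)
qed

lemma biclique_path_graph_of_least:
  assumes "m \<in> A" and "\<And>x. x \<in> A \<union> B \<Longrightarrow> m \<le> x"
    and "B \<noteq> {}" and biclique: "A \<times> B \<subseteq> parcs (path_graph n)"
  shows "A \<union> B \<in> path_segments n 2 \<union> path_segments n 3"
proof -
  have adj: "a < n \<and> b < n \<and> (b = Suc a \<or> a = Suc b)" if "a \<in> A" "b \<in> B" for a b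
    using biclique that by auto
  have "b = Suc m" if "b \<in> B" for b
    using adj[OF \<open>m \<in> A\<close> that] assms(2)[of b] that by auto
  then have B_eq: "B = {Suc m}"
    using \<open>B \<noteq> {}\<close> by blast
  have "a = m \<or> a = m + 2" if "a \<in> A" for a
    using adj[OF that, of "Suc m"] B_eq by auto
  then consider (singleton) "A = {m}" | (pair) "A = {m, m + 2}"
    using \<open>m \<in> A\<close> by blast
  then show ?thesis
  proof cases
    case singleton
    then have "A \<union> B = {m..<m + 2}"
      using B_eq by auto
    moreover have "m + 2 \<le> n"
      using adj[of m "Suc m"] singleton B_eq by auto
    ultimately show ?thesis
      using path_segmentsI[of m 2 n] by simp
  next
    case pair
    then have "A \<union> B = {m..<m + 3}"
      using B_eq by auto
    moreover have "m + 3 \<le> n"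
      using adj[of "m + 2" "Suc m"] pair B_eq by auto
    ultimately show ?thesis
      using path_segmentsI[of m 3 n] by simp
  qed
qed

lemma biclique_path_graph:
  assumes "A \<noteq> {}" "B \<noteq> {}" and biclique: "A \<times> B \<subseteq> parcs (path_graph n)"
  shows "A \<union> B \<in> path_segments n 2 \<union> path_segments n 3"
proof -
  define m where "m = (LEAST x. x \<in> A \<union> B)"
  have m_le: "m \<le> x" if "x \<in> A \<union> B" for x
    unfolding m_def using that by (rule Least_le)
  have "m \<in> A \<union> B"
    using \<open>A \<noteq> {}\<close> unfolding m_def by (metis LeastI UnI1 all_not_in_conv)
  then show ?thesis
  proof
    assume "m \<in> A"
    then show ?thesis
      using m_le \<open>B \<noteq> {}\<close> biclique by (rule biclique_path_graph_of_least)
  next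
    assume "m \<in> B"
    moreover have "m \<le> x" if "x \<in> B \<union> A" for x
      using that m_le by blast
    moreover have "B \<times> A \<subseteq> parcs (path_graph n)"
      using biclique by auto
    ultimately have "B \<union> A \<in> path_segments n 2 \<union> path_segments n 3"
      using \<open>A \<noteq> {}\<close> by (intro biclique_path_graph_of_least)
    then show ?thesis
      by (simp add: Un_commute)
  qed
qed

lemma disconnected_sets_complement_path_graph:
  "disconnected_sets (complement_graph (path_graph n)) = path_segments n 2 \<union> path_segments n 3"
proof -
  interpret pair_graph "path_graph n"
    by (rule pair_graph_path_graph)
  have "\<exists>A B. S = A \<union> B \<and> A \<noteq> {} \<and> B \<noteq> {} \<and> A \<times> B \<subseteq> parcs (path_graph n)"
    if segment: "S \<in> path_segments n 2 \<union> path_segments n 3" for S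
  proof -
    from segment consider (pair) i where "S = {i..<i + 2}" "i + 2 \<le> n"
      | (triple) i where "S = {i..<i + 3}" "i + 3 \<le> n"
      by (auto simp: path_segments_def)
    then show ?thesis
    proof cases
      case (pair i)
      then show ?thesis
        by (intro exI[of _ "{i}"] exI[of _ "{i + 1}"]) auto
    next
      case (triple i)
      then show ?thesis
        by (intro exI[of _ "{i, i + 2}"] exI[of _ "{i + 1}"]) auto
    qed
  qed
  then show ?thesis
    using biclique_path_graph[of _ _ n]
    unfolding disconnected_sets_complement_graph by blast
qed

lemma poly_NRel_complement_path_graph:
  "poly (NRel (complement_graph (path_graph n))) p = 1 - (1 - p) ^ n
     - real (n - 1) * (p ^ 2 * (1 - p) ^ (n - 2)) - real (n - 2) * (p ^ 3 * (1 - p) ^ (n - 3))"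
proof -
  define t where "t k = p ^ k * (1 - p) ^ (n - k)" for k
  have "(\<Sum>S\<in>path_segments n k. t (card S)) = real (Suc n - k) * t k" if "k > 0" for k
    using that by (simp add: card_mem_path_segments card_path_segments)
  moreover have "path_segments n 2 \<inter> path_segments n 3 = {}"
    by (auto simp: disjoint_iff dest!: card_mem_path_segments)
  ultimately have "(\<Sum>S\<in>path_segments n 2 \<union> path_segments n 3. t (card S)) =
      real (n - 1) * t 2 + real (n - 2) * t 3"
    by (simp add: sum.union_disjoint finite_path_segments)
  then show ?thesis
    by (simp add: poly_NRel_eq_sum_disconnected disconnected_sets_complement_path_graph t_def)
qed

lemma poly_NRel_complement_path_graph_reciprocal:
  fixes w :: real
  assumes "n \<ge> 3" and "w \<noteq> 0"
  shows "w ^ n * poly (NRel (complement_graph (path_graph n))) (1 - 1 / w) =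
    w ^ n - 1 - (w - 1)\<^sup>2 * (1 + real (n - 2) * w)"
proof -
  obtain m where "n = m + 3"
    using assms(1) by (metis add.commute le_Suc_ex)
  then show ?thesis
    using assms(2)
    by (simp add: poly_NRel_complement_path_graph field_simps power_add
        power2_eq_square power3_eq_cube)
qed

lemma exists_small_negative_root:
  fixes c e :: real
  assumes "n > 0" and "0 < e" "e \<le> 1" and "3 \<le> c * e"
  shows "\<exists>w. - e \<le> w \<and> w < 0 \<and> w ^ n - 1 - (w - 1)\<^sup>2 * (1 + c * w) = 0"
proof -
  define f where "f w = w ^ n - 1 - (w - 1)\<^sup>2 * (1 + c * w)" for w :: real
  have "f 0 = - 2"
    using assms(1) by (simp add: f_def)
  have "f (- e) \<ge> 0"
  proof -
    have "1 \<le> (- e - 1)\<^sup>2"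
      using assms(2) by (simp add: power2_eq_square algebra_simps)
    then have "1 * 2 \<le> (- e - 1)\<^sup>2 * (c * e - 1)"
      using assms(4) by (intro mult_mono) auto
    moreover have "\<bar>(- e) ^ n\<bar> \<le> 1"
      using assms(2,3) by (simp add: power_abs power_le_one)
    moreover have "f (- e) = (- e) ^ n - 1 + (- e - 1)\<^sup>2 * (c * e - 1)"
      by (simp add: f_def right_diff_distrib)
    ultimately show ?thesis
      by linarith
  qed
  moreover have "continuous_on {- e..0} f"
    unfolding f_def by (intro continuous_intros)
  ultimately obtain w where "- e \<le> w" "w \<le> 0" "f w = 0"
    using IVT2'[of f 0 0 "- e"] \<open>f 0 = - 2\<close> assms(2) by auto
  moreover from this have "w \<noteq> 0"
    using \<open>f 0 = - 2\<close> by auto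
  ultimately show ?thesis
    by (auto simp: f_def)
qed

lemma exists_large_root_NRel_complement_path_graph:
  fixes M :: real
  shows "\<exists>n r. n > 0 \<and> r > M \<and> poly (NRel (complement_graph (path_graph n))) r = 0"
proof -
  define e where "e = 1 / max 1 M"
  have e_bounds: "0 < e" "e \<le> 1" "M \<le> 1 / e"
    by (auto simp: e_def)
  obtain N :: nat where "3 / e < real N"
    using reals_Archimedean2 by blast
  define n where "n = N + 3"
  have n_large: "n \<ge> 3" "3 \<le> real (n - 2) * e"
    using \<open>3 / e < real N\<close> e_bounds by (simp_all add: n_def field_simps)
  then obtain w where w_root: "- e \<le> w" "w < 0"
      "w ^ n - 1 - (w - 1)\<^sup>2 * (1 + real (n - 2) * w) = 0"
    using exists_small_negative_root[of n e "real (n - 2)"] e_bounds by auto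
  then have "w ^ n * poly (NRel (complement_graph (path_graph n))) (1 - 1 / w) = 0"
    using n_large(1) by (simp add: poly_NRel_complement_path_graph_reciprocal)
  then have "poly (NRel (complement_graph (path_graph n))) (1 - 1 / w) = 0"
    using \<open>w < 0\<close> by simp
  moreover have "1 / e \<le> - 1 / w"
    using w_root(1,2) e_bounds(1) by (simp add: field_simps)
  with e_bounds(3) have "1 - 1 / w > M"
    by simp
  ultimately show ?thesis
    using n_large(1) by (intro exI[of _ n] exI[of _ "1 - 1 / w"]) simp
qed

theorem theorem4:
  shows "\<not> bounded {r :: real. \<exists>G :: nat pair_pre_digraph.
           pair_graph G \<and> pverts G \<noteq> {} \<and> poly (NRel G) r = 0}"
proof
  assume "bounded {r :: real. \<exists>G :: nat pair_pre_digraph.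
           pair_graph G \<and> pverts G \<noteq> {} \<and> poly (NRel G) r = 0}" (is "bounded ?roots")
  then obtain M where root_le: "\<forall>r\<in>?roots. \<bar>r\<bar> \<le> M"
    unfolding bounded_real ..
  obtain n r where "n > 0" "r > M" and root: "poly (NRel (complement_graph (path_graph n))) r = 0"
    using exists_large_root_NRel_complement_path_graph by blast
  interpret pair_graph "path_graph n"
    by (rule pair_graph_path_graph)
  have "pverts (complement_graph (path_graph n)) \<noteq> {}"
    using \<open>n > 0\<close> by (simp add: lessThan_empty_iff)
  then have "r \<in> ?roots"
    using pair_graph_complement_graph root by blast
  then have "\<bar>r\<bar> \<le> M"
    by (rule root_le[rule_format])
  with \<open>r > M\<close> show False
    by simp
qed

end
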